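(* Let $n\ge0$ be an integer and $k=6n+5$. Define polynomials $P_m(x),Q_m(x)$ by $P_0=1$, $P_1=x$, $Q_0=0$, $Q_1=1$ and, for $m\ge1$, $P_{m+1}(x)=xP_m(x)+\lambda_mP_{m-1}(x)$, $Q_{m+1}(x)=xQ_m(x)+\lambda_mQ_{m-1}(x)$, where $\lambda_m=12\frac{(6m+1)(6m+5)}{m(m+1)}$. Then the function $$\sqrt{\Delta(\tau)}^{\,n}P_n\Big(\frac{E_6(\tau)}{\sqrt{\Delta(\tau)}}\Big)\frac{E_4'(\tau)}{240}-\sqrt{\Delta(\tau)}^{\,n+1}Q_n\Big(\frac{E_6(\tau)}{\sqrt{\Delta(\tau)}}\Big)$$ is a quasimodular form of weight $k+1$ on $\mathrm{SL}_2(\mathbb Z)$ and is a solution of the differential equation $$f''(\tau)-\frac{k+1}{6}E_2(\tau)f'(\tau)+\frac{k(k+1)}{12}E_2'(\tau)f(\tau)=0 .$$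
   Context: $\tau\in\mathfrak H$, $q=e^{2\pi i\tau}$, and ${}'$ denotes $\frac1{2\pi i}\frac{d}{d\tau}=q\frac d{dq}$. $E_2=1-24\sum_{n\ge1}\sigma_1(n)q^n$, $E_4=1+240\sum_{n\ge1}\sigma_3(n)q^n$, $E_6=1-504\sum_{n\ge1}\sigma_5(n)q^n$ with $\sigma_m(n)=\sum_{d|n}d^m$, and $\Delta=(E_4^3-E_6^2)/1728$; one has $E_4'=(E_2E_4-E_6)/3$. Since $P_m$ has the parity of $m$ and $Q_m$ the opposite parity, the square roots of $\Delta$ cancel and the expression is a polynomial in $E_2,E_4,E_6$. A quasimodular form of weight $w$ on $\mathrm{SL}_2(\mathbb Z)$ is a homogeneous element of degree $w$ in $\mathbb C[E_2,E_4,E_6]$, where $E_2,E_4,E_6$ have degrees $2,4,6$. *)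

theory Defs
  imports "HOL-Complex_Analysis.Complex_Analysis" "HOL-Computational_Algebra.Polynomial"
begin

definition Dq :: "(complex \<Rightarrow> complex) \<Rightarrow> complex \<Rightarrow> complex" where
  "Dq f \<tau> = deriv f \<tau> / (2 * of_real pi * \<i>)"

definition qvar :: "complex \<Rightarrow> complex" where
  "qvar \<tau> = exp (2 * of_real pi * \<i> * \<tau>)"

definition sigma :: "nat \<Rightarrow> nat \<Rightarrow> nat" where
  "sigma m n = (\<Sum>d\<in>{d. d dvd n}. d ^ m)"

definition E2 :: "complex \<Rightarrow> complex" where
  "E2 \<tau> = 1 - 24 * (\<Sum>n. of_nat (sigma 1 (Suc n)) * qvar \<tau> ^ Suc n)"

definition E4 :: "complex \<Rightarrow> complex" where
  "E4 \<tau> = 1 + 240 * (\<Sum>n. of_nat (sigma 3 (Suc n)) * qvar \<tau> ^ Suc n)"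

definition E6 :: "complex \<Rightarrow> complex" where
  "E6 \<tau> = 1 - 504 * (\<Sum>n. of_nat (sigma 5 (Suc n)) * qvar \<tau> ^ Suc n)"

definition Delta :: "complex \<Rightarrow> complex" where
  "Delta \<tau> = (E4 \<tau> ^ 3 - E6 \<tau> ^ 2) / 1728"

definition lam :: "nat \<Rightarrow> complex" where
  "lam m = 12 * of_nat ((6*m+1)*(6*m+5)) / of_nat (m*(m+1))"

fun Pp :: "nat \<Rightarrow> complex poly" where
  "Pp 0 = 1"
| "Pp (Suc 0) = [:0, 1:]"
| "Pp (Suc (Suc m)) = [:0, 1:] * Pp (Suc m) + smult (lam (Suc m)) (Pp m)"

fun Qp :: "nat \<Rightarrow> complex poly" where
  "Qp 0 = 0"
| "Qp (Suc 0) = 1"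
| "Qp (Suc (Suc m)) = [:0, 1:] * Qp (Suc m) + smult (lam (Suc m)) (Qp m)"

definition quasimodular :: "nat \<Rightarrow> (complex \<Rightarrow> complex) \<Rightarrow> bool" where
  "quasimodular w f \<longleftrightarrow>
     (\<exists>c :: nat \<Rightarrow> nat \<Rightarrow> nat \<Rightarrow> complex. \<forall>\<tau>. Im \<tau> > 0 \<longrightarrow>
        f \<tau> = (\<Sum>(a,b,d)\<in>{(a,b,d). 2*a + 4*b + 6*d = w}.
                   c a b d * E2 \<tau> ^ a * E4 \<tau> ^ b * E6 \<tau> ^ d))"

text \<open>The function of the theorem; the square root of Delta is taken pointwise
  (principal branch); by parity of P_n, Q_n the value does not depend on the branch.\<close>
definition Fn :: "nat \<Rightarrow> complex \<Rightarrow> complex" where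
  "Fn n \<tau> = (let s = csqrt (Delta \<tau>) in
      s ^ n * poly (Pp n) (E6 \<tau> / s) * Dq E4 \<tau> / 240
      - s ^ (n+1) * poly (Qp n) (E6 \<tau> / s))"

end

theory Submission
  imports Defs
begin

text \<open>Homogenising the recursions of \<open>P\<^sub>n\<close> and \<open>Q\<^sub>n\<close>, the function of the theorem satisfies
  \<open>f\<^sub>n\<^sub>+\<^sub>2 = E\<^sub>6 f\<^sub>n\<^sub>+\<^sub>1 + \<lambda>\<^sub>n\<^sub>+\<^sub>1 \<Delta> f\<^sub>n\<close> with \<open>f\<^sub>0 = (E\<^sub>2 E\<^sub>4 - E\<^sub>6) / 720\<close> and
  \<open>f\<^sub>1 = E\<^sub>6 f\<^sub>0 - \<Delta>\<close>, which gives quasimodularity. With \<open>k = 6n + 5\<close> and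
  \<open>h = f\<^sub>n' - k E\<^sub>2 f\<^sub>n / 12\<close>, the differential equation is
  \<open>h' - (k + 2) E\<^sub>2 h / 12 = k (k + 2) E\<^sub>4 f\<^sub>n / 144\<close>; it is proved by induction together with
  \<open>(n + 1) f\<^sub>n\<^sub>+\<^sub>1 = (k + 2) E\<^sub>6 f\<^sub>n / 12 - E\<^sub>4 h\<close>.

  Ramanujan's formulas for \<open>E\<^sub>2'\<close>, \<open>E\<^sub>4'\<close> and \<open>E\<^sub>6'\<close> amount to convolution identities for the divisor
  sums, which follow by summing polynomials \<open>F(a, b)\<close> over the solutions of \<open>ax + by = n\<close> and
  reducing the solutions by one step of the Euclidean algorithm. They imply \<open>\<Delta>' = E\<^sub>2 \<Delta>\<close>, so that
  \<open>\<Delta>\<close> has no zeros and the division by its square root is harmless.\<close>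

subsection \<open>Convolutions of divisor sums\<close>

text \<open>The tuple encodes a divisor \<open>a\<close> of \<open>k = a * x\<close> and a divisor
  \<open>b\<close> of \<open>n - k = b * y\<close>. Sums over \<open>quads n\<close> are therefore
  convolutions of divisor sums.\<close>

definition quads :: "nat \<Rightarrow> (nat \<times> nat \<times> nat \<times> nat) set" where
  "quads n = {(a, b, x, y). 0 < a \<and> 0 < b \<and> 0 < x \<and> 0 < y \<and> a * x + b * y = n}"

lemma finite_quads: "finite (quads n)"
proof (rule finite_subset)
  have "a \<le> a * x + b * y" "x \<le> a * x + b * y" "b \<le> a * x + b * y" "y \<le> a * x + b * y"
    if "0 < a" "0 < x" "0 < b" "0 < y" for a b x y :: nat
    using that by (simp_all add: trans_le_add1 trans_le_add2)
  then show "quads n \<subseteq> {..n} \<times> {..n} \<times> {..n} \<times> {..n}"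
    by (auto simp: quads_def)
qed simp

lemma sum_quads_swap: "(\<Sum>(a,b,x,y)\<in>quads n. g a b) = (\<Sum>(a,b,x,y)\<in>quads n. g b a)"
  by (rule sum.reindex_bij_witness
        [where i = "\<lambda>(a,b,x,y). (b,a,y,x)" and j = "\<lambda>(a,b,x,y). (b,a,y,x)"])
     (auto simp: quads_def)

text \<open>For x = y the equation is (a + b) x = n, so d = a + b runs through the divisors of n,
  and a through 0 < a < d.\<close>

lemma sum_quads_diagonal:
  assumes "n > 0"
  shows "(\<Sum>(a,b,x,y)\<in>quads n \<inter> {(a,b,x,y). x = y}. g a b)
    = (\<Sum>d | d dvd n. \<Sum>a\<in>{0<..<d}. g a (d - a))"
proof -
  have "finite {d. d dvd n}" using assms by auto
  then have "(\<Sum>d | d dvd n. \<Sum>a\<in>{0<..<d}. g a (d - a))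
      = (\<Sum>(d,a)\<in>(SIGMA d:{d. d dvd n}. {0<..<d}). g a (d - a))"
    by (subst sum.Sigma) auto
  also have "\<dots> = (\<Sum>(a,b,x,y)\<in>quads n \<inter> {(a,b,x,y). x = y}. g a b)"
    by (rule sum.reindex_bij_witness[where i = "\<lambda>(a,b,x,y). (a+b,a)"
          and j = "\<lambda>(d,a). (a, d-a, n div d, n div d)"])
       (use assms in \<open>auto simp: quads_def distrib_right[symmetric] elim!: dvdE\<close>)
  finally show ?thesis by simp
qed

text \<open>For a = b the equation is a (x + y) = n, which leaves n/a - 1 choices of x for each
  divisor a.\<close>

lemma sum_quads_equal:
  fixes g :: "nat \<Rightarrow> 'a::comm_ring_1"
  assumes "n > 0"
  shows "(\<Sum>(a,b,x,y)\<in>quads n \<inter> {(a,b,x,y). a = b}. g a)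
    = (\<Sum>d | d dvd n. (of_nat (n div d) - 1) * g d)"
proof -
  have fin: "finite {d. d dvd n}" using assms by auto
  have "(\<Sum>d | d dvd n. (of_nat (n div d) - 1) * g d)
      = (\<Sum>d | d dvd n. \<Sum>x\<in>{0<..<n div d}. g d)"
    using assms by (intro sum.cong) (auto simp: of_nat_diff Suc_leI elim!: dvdE)
  also have "\<dots> = (\<Sum>(d,x)\<in>(SIGMA d:{d. d dvd n}. {0<..<n div d}). g d)"
    using fin by (subst sum.Sigma) auto
  also have "\<dots> = (\<Sum>(a,b,x,y)\<in>quads n \<inter> {(a,b,x,y). a = b}. g a)"
    by (rule sum.reindex_bij_witness[where i = "\<lambda>(a,b,x,y). (a,x)"
          and j = "\<lambda>(d,x). (d, d, x, n div d - x)"])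
       (use assms in \<open>auto simp: quads_def distrib_left[symmetric] elim!: dvdE\<close>)
  finally show ?thesis by simp
qed

lemma shear_cancel:
  fixes x y :: nat
  assumes "x < y"
  shows "a * x + (a * y + b - a * x) = a * y + b" "x * a + (y * a + b - x * a) = y * a + b"
  using assms by (simp_all add: trans_le_add1)

text \<open>One Euclidean step: a x + b y = a (x - y) + (a + b) y, so the shear stays inside the
  solution set.\<close>

lemma sum_quads_shear:
  "(\<Sum>(a,b,x,y)\<in>quads n \<inter> {(a,b,x,y). y < x}. g a b)
    = (\<Sum>(a,b,x,y)\<in>quads n \<inter> {(a,b,x,y). a < b}. g a (b - a))"
  by (rule sum.reindex_bij_witness[where i = "\<lambda>(a,b,x,y). (a,b-a,x+y,y)"
        and j = "\<lambda>(a,b,x,y). (a,a+b,x-y,y)"])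
     (auto simp: quads_def algebra_simps shear_cancel)

lemma sum_quads_shear':
  "(\<Sum>(a,b,x,y)\<in>quads n \<inter> {(a,b,x,y). x < y}. g a b)
    = (\<Sum>(a,b,x,y)\<in>quads n \<inter> {(a,b,x,y). b < a}. g (a - b) b)"
  by (rule sum.reindex_bij_witness[where i = "\<lambda>(a,b,x,y). (a-b,b,x,x+y)"
        and j = "\<lambda>(a,b,x,y). (a+b,b,x,y-x)"])
     (auto simp: quads_def algebra_simps shear_cancel)

text \<open>The compared quantities are parameters because two splittings are needed: by
  \<open>x\<close> against \<open>y\<close> and by \<open>b\<close> against
  \<open>a\<close>.\<close>

lemma sum_quads_split:
  fixes P :: "nat \<Rightarrow> nat \<Rightarrow> nat \<Rightarrow> nat \<Rightarrow> nat"
  shows "(\<Sum>(a,b,x,y)\<in>quads n. g a b)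
    = (\<Sum>(a,b,x,y)\<in>quads n \<inter> {(a,b,x,y). P a b x y < Q a b x y}. g a b)
    + (\<Sum>(a,b,x,y)\<in>quads n \<inter> {(a,b,x,y). Q a b x y < P a b x y}. g a b)
    + (\<Sum>(a,b,x,y)\<in>quads n \<inter> {(a,b,x,y). P a b x y = Q a b x y}. g a b)"
  (is "_ = sum _ ?A + sum _ ?B + sum _ ?C")
proof -
  have "quads n = (?A \<union> ?B) \<union> ?C"
    by auto
  moreover have "finite ?A" "finite ?B" "finite ?C" using finite_quads by auto
  ultimately show ?thesis
    by (subst \<open>quads n = _\<close>, subst sum.union_disjoint; (subst sum.union_disjoint)?) auto
qed

text \<open>The shears \<open>(a, b, x, y) \<mapsto> (a, a + b, x - y, y)\<close> for \<open>x > y\<close> and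
  \<open>(a, b, x, y) \<mapsto> (a + b, b, x, y - x)\<close> for \<open>x < y\<close> fold both halves of the sum of
  \<open>F(a, b)\<close> onto the sum of \<open>F(a, - b)\<close>, leaving only the diagonals \<open>x = y\<close> and \<open>a = b\<close>.\<close>
lemma sum_quads_odd_part:
  fixes F :: "'a::comm_ring_1 \<Rightarrow> 'a \<Rightarrow> 'a"
  assumes "n > 0" and sym: "\<And>a b. F a b = F b a" and rot: "\<And>a b. F a b = F b (- a - b)"
    and even: "\<And>a b. F (- a) (- b) = F a b"
  shows "(\<Sum>(a,b,x,y)\<in>quads n. F (of_nat a) (of_nat b) - F (of_nat a) (- of_nat b))
    = (\<Sum>d | d dvd n. (\<Sum>a<d. F (of_nat a) (of_nat d - of_nat a)) - of_nat (n div d) * F (of_nat d) 0)"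
proof -
  let ?F = "\<lambda>a b. F (of_nat a) (of_nat b)" and ?G = "\<lambda>a b. F (of_nat a) (- of_nat b)"
  \<comment> \<open>By \<open>sym\<close> and \<open>rot\<close>, F depends only on the unordered
    triple a, b, -a-b. Here both sides belong to a, -b, b-a. The triple a-b, b, -a in
    \<open>G2\<close> is its negative, whence \<open>even\<close>.\<close>
  have G1: "F a (b - a) = F a (- b)" for a b
    by (metis sym rot add_diff_cancel_left' diff_minus_eq_add minus_diff_eq uminus_add_conv_diff diff_add_cancel)
  have G2: "F (a - b) b = F a (- b)" for a b
    using G1[of b a] sym even by (metis minus_minus)
  have G0: "F a (- a) = F a 0" for a
    using G1[of a 0] G1[of a a] by simp
  have F: "(\<Sum>(a,b,x,y)\<in>quads n. ?F a b) = 
      (\<Sum>(a,b,x,y)\<in>quads n \<inter> {(a,b,x,y). b < a}. ?G a b)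
      + (\<Sum>(a,b,x,y)\<in>quads n \<inter> {(a,b,x,y). a < b}. ?G a b)
      + (\<Sum>d | d dvd n. \<Sum>a\<in>{0<..<d}. ?F a (d - a))"
    unfolding sum_quads_diagonal[OF \<open>n > 0\<close>, of ?F, symmetric]
    unfolding sum_quads_split[of ?F n "\<lambda>a b x y. x" "\<lambda>a b x y. y"] sum_quads_shear sum_quads_shear'
    by (intro arg_cong2[where f = "(+)"] refl sum.cong) (auto simp: G1 G2 of_nat_diff)
  have G: "(\<Sum>(a,b,x,y)\<in>quads n. ?G a b) = 
      (\<Sum>(a,b,x,y)\<in>quads n \<inter> {(a,b,x,y). b < a}. ?G a b)
      + (\<Sum>(a,b,x,y)\<in>quads n \<inter> {(a,b,x,y). a < b}. ?G a b)
      + (\<Sum>d | d dvd n. (of_nat (n div d) - 1) * F (of_nat d) 0)"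
    unfolding sum_quads_equal[OF \<open>n > 0\<close>, symmetric, of "\<lambda>d. F (of_nat d) 0"]
    unfolding sum_quads_split[of ?G n "\<lambda>a b x y. b" "\<lambda>a b x y. a"]
    by (intro arg_cong2[where f = "(+)"] sum.cong) (auto simp: G0)
  \<comment> \<open>The extra term a = 0, equal to F(d, 0), absorbs the -1 in the number n/d - 1 of
    solutions with a = b.\<close>
  have "(\<Sum>a<d. F (of_nat a) (of_nat d - of_nat a)) = F (of_nat d) 0 + (\<Sum>a\<in>{0<..<d}. ?F a (d - a))"
    if "d > 0" for d
  proof -
    have "{..<d} = insert 0 {0<..<d}" using that by auto
    then show ?thesis by (simp add: sym[of 0] of_nat_diff)
  qed
  then have "(\<Sum>d | d dvd n. (\<Sum>a<d. F (of_nat a) (of_nat d - of_nat a)) - of_nat (n div d) * F (of_nat d) 0)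
     = (\<Sum>d | d dvd n. (\<Sum>a\<in>{0<..<d}. ?F a (d - a)) - (of_nat (n div d) - 1) * F (of_nat d) 0)"
    using \<open>n > 0\<close> by (intro sum.cong) (auto simp: algebra_simps dvd_pos_nat)
  then show ?thesis
    using F G by (simp add: sum_subtractf case_prod_unfold)
qed

text \<open>Every number divides 0, and a sum over an infinite set is 0 by convention. This default
  makes the end terms of the convolutions vanish.\<close>

lemma sigma_0 [simp]: "sigma m 0 = 0"
  by (simp add: sigma_def)

text \<open>The solutions are grouped by k = a x; then x and y are the cofactors of a in k and of b
  in n - k.\<close>

lemma sum_quads_sigma:
  "(\<Sum>(a,b,x,y)\<in>quads n. of_nat a ^ i * of_nat b ^ j :: 'a::comm_semiring_1)
     = (\<Sum>k=0..n. of_nat (sigma i k) * of_nat (sigma j (n - k)))"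
proof -
  have "(\<Sum>k=0..n. of_nat (sigma i k) * of_nat (sigma j (n - k)) :: 'a)
      = (\<Sum>k\<in>{0<..<n}. of_nat (sigma i k) * of_nat (sigma j (n - k)))"
  proof (rule sum.mono_neutral_right)
    show "\<forall>k\<in>{0..n} - {0<..<n}. of_nat (sigma i k) * of_nat (sigma j (n - k)) = (0::'a)"
    proof
      fix k assume "k \<in> {0..n} - {0<..<n}"
      then have "k = 0 \<or> n - k = 0" by auto
      then show "of_nat (sigma i k) * of_nat (sigma j (n - k)) = (0::'a)" by auto
    qed
  qed auto
  also have "\<dots> = (\<Sum>k\<in>{0<..<n}. \<Sum>(a,b)\<in>{a. a dvd k} \<times> {b. b dvd (n - k)}. of_nat a ^ i * of_nat b ^ j)"
    by (intro sum.cong) (auto simp: sigma_def sum_product sum.cartesian_product)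
  also have "\<dots> = (\<Sum>(k,a,b)\<in>(SIGMA k:{0<..<n}. {a. a dvd k} \<times> {b. b dvd (n - k)}). of_nat a ^ i * of_nat b ^ j)"
    by (subst sum.Sigma) auto
  also have "\<dots> = (\<Sum>(a,b,x,y)\<in>quads n. of_nat a ^ i * of_nat b ^ j)"
    by (rule sum.reindex_bij_witness[where i = "\<lambda>(a,b,x,y). (a*x,a,b)"
          and j = "\<lambda>(k,a,b). (a, b, k div a, (n-k) div b)"])
       (auto simp: quads_def elim!: dvdE intro!: Nat.gr0I split: if_splits)
  finally show ?thesis by simp
qed

text \<open>Faulhaber's formulas, cleared of denominators and with a variable \<open>x\<close> for
  the upper limit, so that \<open>algebra\<close> can use them as polynomial relations.\<close>

lemma sum_of_nat_powers:
  fixes x :: complex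
  assumes "x = of_nat d"
  shows "2 * (\<Sum>a<d. of_nat a) = x^2 - x" (is ?t1)
    "6 * (\<Sum>a<d. of_nat a ^ 2) = 2*x^3 - 3*x^2 + x" (is ?t2)
    "4 * (\<Sum>a<d. of_nat a ^ 3) = x^4 - 2*x^3 + x^2" (is ?t3)
    "30 * (\<Sum>a<d. of_nat a ^ 4) = 6*x^5 - 15*x^4 + 10*x^3 - x" (is ?t4)
    "12 * (\<Sum>a<d. of_nat a ^ 5) = 2*x^6 - 6*x^5 + 5*x^4 - x^2" (is ?t5)
    "42 * (\<Sum>a<d. of_nat a ^ 6) = 6*x^7 - 21*x^6 + 21*x^5 - 7*x^3 + x" (is ?t6)
proof -
  note s = sum.lessThan_Suc of_nat_Suc
  show ?t1 unfolding assms by (induction d) (simp, simp only: s, algebra)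
  show ?t2 unfolding assms by (induction d) (simp, simp only: s, algebra)
  show ?t3 unfolding assms by (induction d) (simp, simp only: s, algebra)
  show ?t4 unfolding assms by (induction d) (simp, simp only: s, algebra)
  show ?t5 unfolding assms by (induction d) (simp, simp only: s, algebra)
  show ?t6 unfolding assms by (induction d) (simp, simp only: s, algebra)
qed

lemma sigma_convolutions:
  assumes "n > 0"
  defines "s \<equiv> \<lambda>m. of_nat (sigma m n) :: complex"
  defines "c \<equiv> \<lambda>i j. (\<Sum>k=0..n. of_nat (sigma i k) * of_nat (sigma j (n - k)) :: complex)"
  shows "12 * c 1 1 = 5 * s 3 + (1 - 6 * of_nat n) * s 1"
    and "240 * c 1 3 = 21 * s 5 + (10 - 30 * of_nat n) * s 3 - s 1"
    and "504 * c 1 5 = 20 * s 7 + (21 - 42 * of_nat n) * s 5 + s 1"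
    and "120 * c 3 3 = s 7 - s 3"
proof -
  have c: "(\<Sum>(a,b,x,y)\<in>quads n. of_nat a ^ i * of_nat b ^ j) = c i j" for i j
    unfolding c_def by (rule sum_quads_sigma)
  have c_swap: "c j i = c i j" for i j
    unfolding c[symmetric] by (subst sum_quads_swap) (simp add: mult.commute)
  have combine: "(\<Sum>(a,b,x,y)\<in>quads n. r * (of_nat a ^ i * of_nat b ^ j + of_nat a ^ j * of_nat b ^ i))
     = 2 * r * c i j" for i j r
    using c[of i j] c[of j i] c_swap[of i j]
    by (simp add: case_prod_unfold sum.distrib flip: sum_distrib_left)
  have s: "(\<Sum>d | d dvd n. of_nat d ^ m) = s m" for m
    by (simp add: s_def sigma_def)
  have sn: "(\<Sum>d | d dvd n. of_nat (n div d) * of_nat d ^ Suc m) = of_nat n * s m" for m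
    unfolding s[symmetric] sum_distrib_left by (intro sum.cong) (auto elim!: dvdE)
  \<comment> \<open>\<open>r\<close> is the coefficient of the wanted monomials in F(a, b) - F(a,
    -b), \<open>l\<close> comes from the value of F at b = 0 and produces the term with the factor
    n, and \<open>N\<close> clears the denominators of the power sums.\<close>
  have main: "2 * N * r * c i j = (\<Sum>d | d dvd n. p (of_nat d)) - N * l * (of_nat n * s m)"
    if "\<And>a b. F a b - F a (- b) = r * (a ^ i * b ^ j + a ^ j * b ^ i)"
      and "\<And>a b. F a b = F b a" and "\<And>a b. F a b = F b (- a - b)"
      and "\<And>a b. F (- a) (- b) = F a b"
      and "\<And>a. F a 0 = l * a ^ Suc m"
      and "\<And>d. N * (\<Sum>a<d. F (of_nat a) (of_nat d - of_nat a)) = p (of_nat d)"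
    for F and p :: "complex \<Rightarrow> complex" and r l i j m N
  proof -
    have "2 * r * c i j = (\<Sum>(a,b,x,y)\<in>quads n. F (of_nat a) (of_nat b) - F (of_nat a) (- of_nat b))"
      unfolding that(1) combine ..
    also have "\<dots> = (\<Sum>d | d dvd n. (\<Sum>a<d. F (of_nat a) (of_nat d - of_nat a)) - of_nat (n div d) * F (of_nat d) 0)"
      by (rule sum_quads_odd_part[OF \<open>n > 0\<close>, of F]) (rule that(2-4))+
    also have "\<dots> = (\<Sum>d | d dvd n. \<Sum>a<d. F (of_nat a) (of_nat d - of_nat a)) - l * (of_nat n * s m)"
      by (simp only: sum_subtractf that(5) sum_distrib_left mult.left_commute[of _ l] flip: sn)
    finally have eq: "2 * r * c i j = \<dots>" .
    have "2 * N * r * c i j = N * (2 * r * c i j)"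
      by simp
    then show ?thesis
      by (simp only: eq right_diff_distrib flip: that(6)) (simp add: sum_distrib_left mult.assoc)
  qed
  \<comment> \<open>The elementary symmetric functions, up to sign, of three numbers \<open>a\<close>, \<open>b\<close>, \<open>- a - b\<close> of sum zero:
    \<open>e2\<close> and \<open>e3\<^sup>2\<close> generate the polynomials satisfying the invariance hypotheses of \<open>main\<close>.\<close>
  define e2 e3 where "e2 a b = a^2 + a*b + b^2" and "e3 a b = a*b*(a+b)" for a b :: complex
  have e2: "e2 a b = e2 b a" "e2 a b = e2 b (- a - b)" "e2 (- a) (- b) = e2 a b" for a b
    unfolding e2_def by algebra+
  have e3: "e3 a b = e3 b a" "e3 a b = e3 b (- a - b)" "e3 (- a) (- b) = - e3 a b" for a b
    unfolding e3_def by algebra+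
  have dist: "(\<Sum>d | d dvd n. f d + g d) = (\<Sum>d | d dvd n. f d) + (\<Sum>d | d dvd n. g d)"
    "(\<Sum>d | d dvd n. r * f d) = r * (\<Sum>d | d dvd n. f d)" for f g :: "nat \<Rightarrow> complex" and r
    by (simp_all add: sum.distrib sum_distrib_left)

  have "2 * 6 * 1 * c 1 1 = (\<Sum>d | d dvd n. 5 * of_nat d ^ 3 + 1 * of_nat d ^ 1) - 6 * 1 * (of_nat n * s 1)"
  proof (rule main[where F = "\<lambda>a b. e2 a b"])
    fix a b :: complex
    show "(e2 a b) - (e2 a (- b)) = 1 * (a ^ 1 * b ^ 1 + a ^ 1 * b ^ 1)"
      unfolding e2_def e3_def by algebra
    show "e2 a b = e2 b a"
      by (simp only: e2(1)[of a b] e3(1)[of a b])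
    show "e2 a b = e2 b (- a - b)"
      by (simp only: e2(2)[of a b] e3(2)[of a b])
    show "e2 (- a) (- b) = e2 a b"
      by (simp only: e2(3)[of a b] e3(3)[of a b] power2_minus)
    show "e2 a 0 = 1 * a ^ Suc 1"
      by (simp add: e2_def e3_def power2_eq_square eval_nat_numeral)
  next
    fix d :: nat
    define x :: complex where "x = of_nat d"
    have *: "e2 (of_nat a) (x - of_nat a) = x^2 + (-x) * of_nat a + of_nat a ^ 2" for a
      unfolding e2_def e3_def by algebra
    show "6 * (\<Sum>a<d. e2 (of_nat a) (of_nat d - of_nat a)) = 5 * of_nat d ^ 3 + 1 * of_nat d ^ 1"
      using sum_of_nat_powers[OF x_def]
      unfolding x_def[symmetric] * sum.distrib sum_distrib_left[symmetric] sum_constant card_lessThan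
      by algebra
  qed
  then show "12 * c 1 1 = 5 * s 3 + (1 - 6 * of_nat n) * s 1"
    unfolding dist s by (simp add: algebra_simps)

  have "2 * 30 * 4 * c 1 3 = (\<Sum>d | d dvd n. 21 * of_nat d ^ 5 + (10 * of_nat d ^ 3 + (-1) * of_nat d ^ 1)) - 30 * 1 * (of_nat n * s 3)"
  proof (rule main[where F = "\<lambda>a b. e2 a b ^ 2"])
    fix a b :: complex
    show "(e2 a b ^ 2) - (e2 a (- b) ^ 2) = 4 * (a ^ 1 * b ^ 3 + a ^ 3 * b ^ 1)"
      unfolding e2_def e3_def by algebra
    show "e2 a b ^ 2 = e2 b a ^ 2"
      by (simp only: e2(1)[of a b] e3(1)[of a b])
    show "e2 a b ^ 2 = e2 b (- a - b) ^ 2"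
      by (simp only: e2(2)[of a b] e3(2)[of a b])
    show "e2 (- a) (- b) ^ 2 = e2 a b ^ 2"
      by (simp only: e2(3)[of a b] e3(3)[of a b] power2_minus)
    show "e2 a 0 ^ 2 = 1 * a ^ Suc 3"
      by (simp add: e2_def e3_def power2_eq_square eval_nat_numeral)
  next
    fix d :: nat
    define x :: complex where "x = of_nat d"
    have *: "e2 (of_nat a) (x - of_nat a) ^ 2 = x^4 + (-2*x^3) * of_nat a + (3*x^2) * of_nat a ^ 2 + (-2*x) * of_nat a ^ 3 + of_nat a ^ 4" for a
      unfolding e2_def e3_def by algebra
    show "30 * (\<Sum>a<d. e2 (of_nat a) (of_nat d - of_nat a) ^ 2) = 21 * of_nat d ^ 5 + (10 * of_nat d ^ 3 + (-1) * of_nat d ^ 1)"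
      using sum_of_nat_powers[OF x_def]
      unfolding x_def[symmetric] * sum.distrib sum_distrib_left[symmetric] sum_constant card_lessThan
      by algebra
  qed
  then show "240 * c 1 3 = 21 * s 5 + (10 - 30 * of_nat n) * s 3 - s 1"
    unfolding dist s by (simp add: algebra_simps)

  \<comment> \<open>In F(a, b) - F(a, -b) the monomial a^3 b^3 has coefficient 14 for
    \<open>e2 ^ 3\<close> and 4 for \<open>e3 ^ 2\<close>; the weights 2 and -7 cancel it.\<close>
  have "2 * 21 * 12 * c 1 5 = (\<Sum>d | d dvd n. 20 * of_nat d ^ 7 + (21 * of_nat d ^ 5 + 1 * of_nat d ^ 1)) - 21 * 2 * (of_nat n * s 5)"
  proof (rule main[where F = "\<lambda>a b. 2 * e2 a b ^ 3 - 7 * e3 a b ^ 2"])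
    fix a b :: complex
    show "(2 * e2 a b ^ 3 - 7 * e3 a b ^ 2) - (2 * e2 a (- b) ^ 3 - 7 * e3 a (- b) ^ 2) = 12 * (a ^ 1 * b ^ 5 + a ^ 5 * b ^ 1)"
      unfolding e2_def e3_def by algebra
    show "2 * e2 a b ^ 3 - 7 * e3 a b ^ 2 = 2 * e2 b a ^ 3 - 7 * e3 b a ^ 2"
      by (simp only: e2(1)[of a b] e3(1)[of a b])
    show "2 * e2 a b ^ 3 - 7 * e3 a b ^ 2 = 2 * e2 b (- a - b) ^ 3 - 7 * e3 b (- a - b) ^ 2"
      by (simp only: e2(2)[of a b] e3(2)[of a b])
    show "2 * e2 (- a) (- b) ^ 3 - 7 * e3 (- a) (- b) ^ 2 = 2 * e2 a b ^ 3 - 7 * e3 a b ^ 2"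
      by (simp only: e2(3)[of a b] e3(3)[of a b] power2_minus)
    show "2 * e2 a 0 ^ 3 - 7 * e3 a 0 ^ 2 = 2 * a ^ Suc 5"
      by (simp add: e2_def e3_def power2_eq_square eval_nat_numeral)
  next
    fix d :: nat
    define x :: complex where "x = of_nat d"
    have *: "2 * e2 (of_nat a) (x - of_nat a) ^ 3 - 7 * e3 (of_nat a) (x - of_nat a) ^ 2 = 2*x^6 + (-6*x^5) * of_nat a + (5*x^4) * of_nat a ^ 2 + (5*x^2) * of_nat a ^ 4 + (-6*x) * of_nat a ^ 5 + 2 * of_nat a ^ 6" for a
      unfolding e2_def e3_def by algebra
    show "21 * (\<Sum>a<d. 2 * e2 (of_nat a) (of_nat d - of_nat a) ^ 3 - 7 * e3 (of_nat a) (of_nat d - of_nat a) ^ 2) = 20 * of_nat d ^ 7 + (21 * of_nat d ^ 5 + 1 * of_nat d ^ 1)"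
      using sum_of_nat_powers[OF x_def]
      unfolding x_def[symmetric] * sum.distrib sum_distrib_left[symmetric] sum_constant card_lessThan
      by algebra
  qed
  then show "504 * c 1 5 = 20 * s 7 + (21 - 42 * of_nat n) * s 5 + s 1"
    unfolding dist s by (simp add: algebra_simps)

  \<comment> \<open>Since \<open>e3 a 0 = 0\<close>, here \<open>l = 0\<close> and no term with a
    factor n appears.\<close>
  have "2 * 30 * 2 * c 3 3 = (\<Sum>d | d dvd n. 1 * of_nat d ^ 7 + (-1) * of_nat d ^ 3) - 30 * 0 * (of_nat n * s 1)"
  proof (rule main[where F = "\<lambda>a b. e3 a b ^ 2"])
    fix a b :: complex
    show "(e3 a b ^ 2) - (e3 a (- b) ^ 2) = 2 * (a ^ 3 * b ^ 3 + a ^ 3 * b ^ 3)"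
      unfolding e2_def e3_def by algebra
    show "e3 a b ^ 2 = e3 b a ^ 2"
      by (simp only: e2(1)[of a b] e3(1)[of a b])
    show "e3 a b ^ 2 = e3 b (- a - b) ^ 2"
      by (simp only: e2(2)[of a b] e3(2)[of a b])
    show "e3 (- a) (- b) ^ 2 = e3 a b ^ 2"
      by (simp only: e2(3)[of a b] e3(3)[of a b] power2_minus)
    show "e3 a 0 ^ 2 = 0 * a ^ Suc 1"
      by (simp add: e2_def e3_def power2_eq_square eval_nat_numeral)
  next
    fix d :: nat
    define x :: complex where "x = of_nat d"
    have *: "e3 (of_nat a) (x - of_nat a) ^ 2 = x^4 * of_nat a ^ 2 + (-2*x^3) * of_nat a ^ 3 + x^2 * of_nat a ^ 4" for a
      unfolding e2_def e3_def by algebra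
    show "30 * (\<Sum>a<d. e3 (of_nat a) (of_nat d - of_nat a) ^ 2) = 1 * of_nat d ^ 7 + (-1) * of_nat d ^ 3"
      using sum_of_nat_powers[OF x_def]
      unfolding x_def[symmetric] * sum.distrib sum_distrib_left[symmetric] sum_constant card_lessThan
      by algebra
  qed
  then show "120 * c 3 3 = s 7 - s 3"
    unfolding dist s by (simp add: algebra_simps)
qed

subsection \<open>Ramanujan's differential equations\<close>

definition sigma_fps :: "nat \<Rightarrow> complex fps" where
  "sigma_fps m = Abs_fps (\<lambda>n. of_nat (sigma m n))"

lemma sigma_fps_nth [simp]: "fps_nth (sigma_fps m) n = of_nat (sigma m n)"
  by (simp add: sigma_fps_def)

lemma sigma_le: "sigma m n \<le> n ^ Suc m"
proof (cases "n = 0")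
  case False
  then have "{d. d dvd n} \<subseteq> {1..n}"
    by (auto dest: dvd_imp_le intro!: Nat.gr0I simp: Suc_le_eq)
  then have "sigma m n \<le> (\<Sum>d\<in>{1..n}. n ^ m)"
    unfolding sigma_def by (intro order.trans[OF sum_mono2 sum_mono]) (auto intro: power_mono)
  then show ?thesis by simp
qed simp

text \<open>Comparison with the power series with coefficients n^(m+1), whose radius is 1 by the
  ratio test.\<close>

lemma conv_radius_sigma_fps: "fps_conv_radius (sigma_fps m) \<ge> 1"
  unfolding fps_conv_radius_def
proof (rule conv_radius_geI_ex')
  fix r :: real
  assume r: "0 < r" "ereal r < 1"
  have "conv_radius (\<lambda>n. of_nat n ^ Suc m :: real) = 1"
  proof (rule conv_radius_ratio_limit)
    show "(\<lambda>n. norm (real n ^ Suc m) / norm (real (Suc n) ^ Suc m)) \<longlonglongrightarrow> 1"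
    proof -
      have "(\<lambda>n. real n / real (Suc n)) \<longlonglongrightarrow> 1"
        by (rule LIMSEQ_n_over_Suc_n)
      then have "(\<lambda>n. (real n / real (Suc n)) ^ Suc m) \<longlonglongrightarrow> 1 ^ Suc m"
        by (rule tendsto_power)
      then show ?thesis by (simp add: power_divide norm_mult norm_power)
    qed
  qed (auto intro: eventually_sequentiallyI[of 1] simp: one_ereal_def)
  with r have "summable (\<lambda>n. real n ^ Suc m * r ^ n)"
    by (intro summable_in_conv_radius) auto
  then show "summable (\<lambda>n. fps_nth (sigma_fps m) n * of_real r ^ n)"
  proof (rule summable_comparison_test')
    fix n :: nat
    have "real (sigma m n) \<le> real n ^ Suc m"
      using sigma_le[of m n] by (metis of_nat_le_iff of_nat_power)
    then show "norm (fps_nth (sigma_fps m) n * of_real r ^ n) \<le> real n ^ Suc m * r ^ n"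
      using r by (simp add: norm_mult norm_power mult_right_mono del: power_Suc)
  qed
qed

definition E2_fps :: "complex fps" where "E2_fps = 1 - 24 * sigma_fps 1"
definition E4_fps :: "complex fps" where "E4_fps = 1 + 240 * sigma_fps 3"
definition E6_fps :: "complex fps" where "E6_fps = 1 - 504 * sigma_fps 5"

lemmas E_fps_defs = E2_fps_def E4_fps_def E6_fps_def

lemma ramanujan_fps:
  "12 * (fps_X * fps_deriv E2_fps) = E2_fps ^ 2 - E4_fps"
  "3 * (fps_X * fps_deriv E4_fps) = E2_fps * E4_fps - E6_fps"
  "2 * (fps_X * fps_deriv E6_fps) = E2_fps * E6_fps - E4_fps ^ 2"
proof -
  let ?S = sigma_fps
  define s where "s m n = (of_nat (sigma m n) :: complex)" for m n
  define c where "c i j n = (\<Sum>k=0..n. of_nat (sigma i k) * of_nat (sigma j (n - k)) :: complex)" for i j n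
  have deriv_nth: "fps_nth (fps_X * fps_deriv f) n = of_nat n * fps_nth f n" for f :: "complex fps" and n
    by (cases n) (simp_all add: fps_X_mult_nth)
  have nth: "fps_nth (?S m) n = s m n" "fps_nth (?S i * ?S j) n = c i j n" for i j m n
    by (auto simp: s_def c_def fps_mult_nth)
  have zero: "s m 0 = 0" "c i j 0 = 0" for m i j
    by (simp_all add: s_def c_def)
  have conv: "12 * c 1 1 n = 5 * s 3 n + (1 - 6 * of_nat n) * s 1 n"
      "240 * c 1 3 n = 21 * s 5 n + (10 - 30 * of_nat n) * s 3 n - s 1 n"
      "504 * c 1 5 n = 20 * s 7 n + (21 - 42 * of_nat n) * s 5 n + s 1 n"
      "120 * c 3 3 n = s 7 n - s 3 n" for n
    using sigma_convolutions[of n] zero unfolding s_def c_def by (cases "n = 0"; simp)+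
  have E: "of_nat n * fps_nth E2_fps n = - 24 * (of_nat n * s 1 n)"
    "of_nat n * fps_nth E4_fps n = 240 * (of_nat n * s 3 n)"
    "of_nat n * fps_nth E6_fps n = - 504 * (of_nat n * s 5 n)" for n
    by (cases "n = 0"; simp add: E_fps_defs nth del: sigma_fps_nth)+
  have prods: "E2_fps ^ 2 - E4_fps = 576 * (?S 1 * ?S 1) - 48 * ?S 1 - 240 * ?S 3"
    "E2_fps * E4_fps - E6_fps = 240 * ?S 3 + 504 * ?S 5 - 24 * ?S 1 - 5760 * (?S 1 * ?S 3)"
    "E2_fps * E6_fps - E4_fps ^ 2
      = 12096 * (?S 1 * ?S 5) - 24 * ?S 1 - 504 * ?S 5 - 480 * ?S 3 - 57600 * (?S 3 * ?S 3)"
    unfolding E_fps_defs by (simp_all add: power2_eq_square algebra_simps)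
  \<comment> \<open>Coefficients of products are the convolutions above. In the third identity the
    \<open>s 7\<close> terms of \<open>c 1 5\<close> and \<open>c 3 3\<close> both carry the factor
    480 and cancel.\<close>
  have nths: "fps_nth (12 * (fps_X * fps_deriv E2_fps)) n = fps_nth (E2_fps ^ 2 - E4_fps) n"
    "fps_nth (3 * (fps_X * fps_deriv E4_fps)) n = fps_nth (E2_fps * E4_fps - E6_fps) n"
    "fps_nth (2 * (fps_X * fps_deriv E6_fps)) n = fps_nth (E2_fps * E6_fps - E4_fps ^ 2) n" for n
    using conv[of n]
    unfolding prods fps_sub_nth fps_add_nth fps_mult_numeral_left deriv_nth nth E
    by algebra+
  show "12 * (fps_X * fps_deriv E2_fps) = E2_fps ^ 2 - E4_fps"
    "3 * (fps_X * fps_deriv E4_fps) = E2_fps * E4_fps - E6_fps"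
    "2 * (fps_X * fps_deriv E6_fps) = E2_fps * E6_fps - E4_fps ^ 2"
    by (rule fps_ext, rule nths)+
qed

section \<open>Evaluation of q-expansions on the unit disc\<close>

lemma eval_fps_unit_disc:
  fixes f g :: "complex fps"
  assumes "norm z < 1" "fps_conv_radius f \<ge> 1"
  shows "fps_conv_radius g \<ge> 1 \<Longrightarrow> eval_fps (f + g) z = eval_fps f z + eval_fps g z"
    "fps_conv_radius g \<ge> 1 \<Longrightarrow> eval_fps (f - g) z = eval_fps f z - eval_fps g z"
    "fps_conv_radius g \<ge> 1 \<Longrightarrow> eval_fps (f * g) z = eval_fps f z * eval_fps g z"
    "eval_fps (f ^ n) z = eval_fps f z ^ n"
    "eval_fps (numeral m * f) z = numeral m * eval_fps f z"
proof -
  have r: "ereal (norm z) < fps_conv_radius h" if "fps_conv_radius h \<ge> 1" for h :: "complex fps"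
    using assms(1) that by (metis ereal_less(3) less_le_trans)
  show "fps_conv_radius g \<ge> 1 \<Longrightarrow> eval_fps (f + g) z = eval_fps f z + eval_fps g z"
    "fps_conv_radius g \<ge> 1 \<Longrightarrow> eval_fps (f - g) z = eval_fps f z - eval_fps g z"
    "fps_conv_radius g \<ge> 1 \<Longrightarrow> eval_fps (f * g) z = eval_fps f z * eval_fps g z"
    "eval_fps (f ^ n) z = eval_fps f z ^ n"
    using r r[OF assms(2)] by (simp_all add: eval_fps_add eval_fps_diff eval_fps_mult eval_fps_power)
  show "eval_fps (numeral m * f) z = numeral m * eval_fps f z"
    using r[OF assms(2)] by (subst eval_fps_mult) auto
qed

lemma conv_radius_ge_1:
  fixes f g :: "complex fps"
  assumes "fps_conv_radius f \<ge> 1"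
  shows "fps_conv_radius g \<ge> 1 \<Longrightarrow> fps_conv_radius (f + g) \<ge> 1"
    "fps_conv_radius g \<ge> 1 \<Longrightarrow> fps_conv_radius (f - g) \<ge> 1"
    "fps_conv_radius g \<ge> 1 \<Longrightarrow> fps_conv_radius (f * g) \<ge> 1"
    "fps_conv_radius (f ^ n) \<ge> 1"
    "fps_conv_radius (numeral m * f) \<ge> 1"
    "fps_conv_radius (fps_X * fps_deriv f) \<ge> 1"
proof -
  show "fps_conv_radius g \<ge> 1 \<Longrightarrow> fps_conv_radius (f + g) \<ge> 1"
    using assms by (intro order.trans[OF _ fps_conv_radius_add]) simp
  show "fps_conv_radius g \<ge> 1 \<Longrightarrow> fps_conv_radius (f - g) \<ge> 1"
    using assms by (intro order.trans[OF _ fps_conv_radius_diff]) simp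
  show "fps_conv_radius g \<ge> 1 \<Longrightarrow> fps_conv_radius (f * g) \<ge> 1"
    using assms by (intro order.trans[OF _ fps_conv_radius_mult]) simp
  show "fps_conv_radius (f ^ n) \<ge> 1"
    using assms by (rule order.trans[OF _ fps_conv_radius_power])
  show "fps_conv_radius (numeral m * f) \<ge> 1"
    using assms by (intro order.trans[OF _ fps_conv_radius_mult]) simp
  show "fps_conv_radius (fps_X * fps_deriv f) \<ge> 1"
    using order.trans[OF assms fps_conv_radius_deriv]
    by (intro order.trans[OF _ fps_conv_radius_mult]) simp
qed

lemma conv_radius_E_fps [simp]:
  "fps_conv_radius E2_fps \<ge> 1" "fps_conv_radius E4_fps \<ge> 1" "fps_conv_radius E6_fps \<ge> 1"
  unfolding E_fps_defs
  by (rule conv_radius_ge_1(1,2), simp, rule conv_radius_ge_1(5), rule conv_radius_sigma_fps)+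

lemma norm_qvar_less_1: "Im \<tau> > 0 \<Longrightarrow> norm (qvar \<tau>) < 1"
  by (simp add: qvar_def)

lemma E_eq_eval_fps:
  assumes "Im \<tau> > 0"
  shows "E2 \<tau> = eval_fps E2_fps (qvar \<tau>)" "E4 \<tau> = eval_fps E4_fps (qvar \<tau>)"
    "E6 \<tau> = eval_fps E6_fps (qvar \<tau>)"
proof -
  note q = norm_qvar_less_1[OF assms]
  have "(\<Sum>n. of_nat (sigma m (Suc n)) * qvar \<tau> ^ Suc n) = eval_fps (sigma_fps m) (qvar \<tau>)" for m
  proof -
    have "ereal (norm (qvar \<tau>)) < fps_conv_radius (sigma_fps m)"
      using q conv_radius_sigma_fps[of m] by (metis ereal_less(3) less_le_trans)
    from suminf_split_head[OF summable_fps[OF this]] show ?thesis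
      by (simp add: eval_fps_def)
  qed
  then show "E2 \<tau> = eval_fps E2_fps (qvar \<tau>)" "E4 \<tau> = eval_fps E4_fps (qvar \<tau>)"
    "E6 \<tau> = eval_fps E6_fps (qvar \<tau>)"
    using q conv_radius_sigma_fps
    by (simp_all add: E2_def E4_def E6_def E_fps_defs eval_fps_unit_disc conv_radius_ge_1)
qed

text \<open>Unlike \<open>Dq\<close>, which rests on the total operator \<open>deriv\<close>, this
  relation records differentiability, so derivatives can be computed by rules. It is confined to the
  upper half-plane, where the q-series converge.\<close>

definition has_Dq :: "(complex \<Rightarrow> complex) \<Rightarrow> (complex \<Rightarrow> complex) \<Rightarrow> bool" where
  "has_Dq f f' \<longleftrightarrow> (\<forall>\<tau>. Im \<tau> > 0 \<longrightarrow>
     (f has_field_derivative 2 * of_real pi * \<i> * f' \<tau>) (at \<tau>))"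

lemma has_Dq_cong:
  assumes "has_Dq f f'" "\<And>\<tau>. Im \<tau> > 0 \<Longrightarrow> f \<tau> = g \<tau>" "\<And>\<tau>. Im \<tau> > 0 \<Longrightarrow> f' \<tau> = g' \<tau>"
  shows "has_Dq g g'"
  unfolding has_Dq_def
proof (intro allI impI)
  fix \<tau> :: complex assume \<tau>: "Im \<tau> > 0"
  then have "(f has_field_derivative 2 * of_real pi * \<i> * g' \<tau>) (at \<tau>)"
    using assms(1,3) by (simp add: has_Dq_def)
  then show "(g has_field_derivative 2 * of_real pi * \<i> * g' \<tau>) (at \<tau>)"
    by (rule has_field_derivative_transform_within_open[where S = "{\<tau>. Im \<tau> > 0}"])
       (use \<tau> assms(2) in \<open>auto simp: open_halfspace_Im_gt\<close>)
qed

lemma has_Dq_add: "has_Dq f f' \<Longrightarrow> has_Dq g g' \<Longrightarrow> has_Dq (\<lambda>\<tau>. f \<tau> + g \<tau>) (\<lambda>\<tau>. f' \<tau> + g' \<tau>)"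
  unfolding has_Dq_def by (auto intro!: derivative_eq_intros simp: algebra_simps)

lemma has_Dq_diff: "has_Dq f f' \<Longrightarrow> has_Dq g g' \<Longrightarrow> has_Dq (\<lambda>\<tau>. f \<tau> - g \<tau>) (\<lambda>\<tau>. f' \<tau> - g' \<tau>)"
  unfolding has_Dq_def by (auto intro!: derivative_eq_intros simp: algebra_simps)

lemma has_Dq_mult:
  "has_Dq f f' \<Longrightarrow> has_Dq g g' \<Longrightarrow> has_Dq (\<lambda>\<tau>. f \<tau> * g \<tau>) (\<lambda>\<tau>. f' \<tau> * g \<tau> + f \<tau> * g' \<tau>)"
  unfolding has_Dq_def by (auto intro!: derivative_eq_intros simp: algebra_simps)

lemma has_Dq_cmult: "has_Dq f f' \<Longrightarrow> has_Dq (\<lambda>\<tau>. c * f \<tau>) (\<lambda>\<tau>. c * f' \<tau>)"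
  unfolding has_Dq_def by (auto intro!: derivative_eq_intros simp: algebra_simps)

lemma Dq_eq: "has_Dq f f' \<Longrightarrow> Im \<tau> > 0 \<Longrightarrow> Dq f \<tau> = f' \<tau>"
  unfolding has_Dq_def Dq_def by (auto dest!: DERIV_imp_deriv)

lemma Dq_Dq_eq:
  assumes "has_Dq f f'" "has_Dq f' f''" "Im \<tau> > 0"
  shows "Dq (Dq f) \<tau> = f'' \<tau>"
proof -
  have "has_Dq (Dq f) f''"
    using assms by (intro has_Dq_cong[OF assms(2)]) (auto simp: Dq_eq)
  then show ?thesis using assms(3) by (rule Dq_eq)
qed

text \<open>The derivative of q is 2 pi i q, so the normalised derivative acts on q-expansions as q
  d/dq.\<close>

lemma has_Dq_eval_fps:
  assumes "fps_conv_radius f \<ge> 1"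
  shows "has_Dq (\<lambda>\<tau>. eval_fps f (qvar \<tau>)) (\<lambda>\<tau>. eval_fps (fps_X * fps_deriv f) (qvar \<tau>))"
  unfolding has_Dq_def
proof (intro allI impI)
  fix \<tau> :: complex assume \<tau>: "Im \<tau> > 0"
  have r: "ereal (norm (qvar \<tau>)) < fps_conv_radius f"
    using norm_qvar_less_1[OF \<tau>] assms by (metis ereal_less(3) less_le_trans)
  then have r': "ereal (norm (qvar \<tau>)) < fps_conv_radius (fps_deriv f)"
    using fps_conv_radius_deriv[of f] by (rule less_le_trans)
  have "(qvar has_field_derivative qvar \<tau> * (2 * of_real pi * \<i>)) (at \<tau>)"
    unfolding qvar_def by (auto intro!: derivative_eq_intros)
  from DERIV_chain2[OF has_field_derivative_eval_fps[OF r] this]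
  show "((\<lambda>\<tau>. eval_fps f (qvar \<tau>)) has_field_derivative
      2 * of_real pi * \<i> * eval_fps (fps_X * fps_deriv f) (qvar \<tau>)) (at \<tau>)"
    using r' by (simp add: eval_fps_mult mult_ac)
qed

lemma ramanujan:
  "has_Dq E2 (\<lambda>\<tau>. (E2 \<tau> ^ 2 - E4 \<tau>) / 12)"
  "has_Dq E4 (\<lambda>\<tau>. (E2 \<tau> * E4 \<tau> - E6 \<tau>) / 3)"
  "has_Dq E6 (\<lambda>\<tau>. (E2 \<tau> * E6 \<tau> - E4 \<tau> ^ 2) / 2)"
proof -
  have "12 * eval_fps (fps_X * fps_deriv E2_fps) (qvar \<tau>) = E2 \<tau> ^ 2 - E4 \<tau>"
    "3 * eval_fps (fps_X * fps_deriv E4_fps) (qvar \<tau>) = E2 \<tau> * E4 \<tau> - E6 \<tau>"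
    "2 * eval_fps (fps_X * fps_deriv E6_fps) (qvar \<tau>) = E2 \<tau> * E6 \<tau> - E4 \<tau> ^ 2"
    if "Im \<tau> > 0" for \<tau>
    using ramanujan_fps[THEN arg_cong[where f = "\<lambda>f. eval_fps f (qvar \<tau>)"]] that
    by (simp_all add: eval_fps_unit_disc norm_qvar_less_1 conv_radius_ge_1 E_eq_eval_fps)
  note eval = this
  show "has_Dq E2 (\<lambda>\<tau>. (E2 \<tau> ^ 2 - E4 \<tau>) / 12)"
    by (rule has_Dq_cong[OF has_Dq_eval_fps[OF conv_radius_E_fps(1)]])
       (simp add: E_eq_eval_fps, simp flip: eval(1))
  show "has_Dq E4 (\<lambda>\<tau>. (E2 \<tau> * E4 \<tau> - E6 \<tau>) / 3)"
    by (rule has_Dq_cong[OF has_Dq_eval_fps[OF conv_radius_E_fps(2)]])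
       (simp add: E_eq_eval_fps, simp flip: eval(2))
  show "has_Dq E6 (\<lambda>\<tau>. (E2 \<tau> * E6 \<tau> - E4 \<tau> ^ 2) / 2)"
    by (rule has_Dq_cong[OF has_Dq_eval_fps[OF conv_radius_E_fps(3)]])
       (simp add: E_eq_eval_fps, simp flip: eval(3))
qed

text \<open>In 3 E4^2 E4' - 2 E6 E6' the terms E4^2 E6 cancel, leaving E2 (E4^3 - E6^2).\<close>

lemma has_Dq_Delta: "has_Dq Delta (\<lambda>\<tau>. E2 \<tau> * Delta \<tau>)"
proof -
  note E4' = ramanujan(2) and E6' = ramanujan(3)
  have "has_Dq (\<lambda>\<tau>. 1 / 1728 * (E4 \<tau> * (E4 \<tau> * E4 \<tau>) - E6 \<tau> * E6 \<tau>))
     (\<lambda>\<tau>. E2 \<tau> * Delta \<tau>)"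
    by (rule has_Dq_cong[OF has_Dq_cmult[OF has_Dq_diff[OF
            has_Dq_mult[OF E4' has_Dq_mult[OF E4' E4']] has_Dq_mult[OF E6' E6']]] refl])
       (simp add: Delta_def field_simps power2_eq_square power3_eq_cube)
  then show ?thesis
    by (rule has_Dq_cong) (simp_all add: Delta_def power2_eq_square power3_eq_cube)
qed

section \<open>Nonvanishing of the discriminant\<close>

lemma qvar_surj:
  assumes "norm z < 1" "z \<noteq> 0"
  obtains \<tau> where "Im \<tau> > 0" "qvar \<tau> = z"
proof
  let ?\<tau> = "Ln z / (2 * of_real pi * \<i>)"
  show "qvar ?\<tau> = z"
    using assms by (simp add: qvar_def)
  have "Im ?\<tau> = - ln (norm z) / (2 * pi)"
    using assms by (simp add: Im_divide power2_eq_square field_simps)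
  then show "Im ?\<tau> > 0"
    using assms by (simp add: divide_neg_pos)
qed

text \<open>Otherwise the q-expansion of E4^3 - E6^2 would vanish on the whole disc and hence be
  zero. The point 0 is not a value of \<open>qvar\<close>; there the constant term 1 - 1 is
  used.\<close>

lemma Delta_not_identically_zero: "\<exists>\<tau>. Im \<tau> > 0 \<and> Delta \<tau> \<noteq> 0"
proof (rule ccontr)
  assume no: "\<not> (\<exists>\<tau>. Im \<tau> > 0 \<and> Delta \<tau> \<noteq> 0)"
  define D where "D = E4_fps ^ 3 - E6_fps ^ 2"
  have radius: "fps_conv_radius D \<ge> 1"
    unfolding D_def by (simp add: conv_radius_ge_1)
  have zero: "eval_fps D z = 0" if z: "norm z < 1" for z
  proof (cases "z = 0")
    case True
    then show ?thesis by (simp add: eval_fps_at_0 D_def E_fps_defs fps_power_zeroth)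
  next
    case False
    then obtain \<tau> where \<tau>: "Im \<tau> > 0" "qvar \<tau> = z"
      using qvar_surj[OF z] by blast
    then show ?thesis
      using no z
      by (auto simp: D_def Delta_def E_eq_eval_fps eval_fps_unit_disc conv_radius_ge_1)
  qed
  have "D = 0"
  proof (rule eval_fps_eqD)
    show "fps_conv_radius D > 0"
      using radius by (rule less_le_trans[rotated]) simp
    have "\<forall>\<^sub>F z in nhds 0. z \<in> ball (0::complex) 1"
      by (intro eventually_nhds_in_open) auto
    then show "\<forall>\<^sub>F z in nhds 0. eval_fps D z = eval_fps 0 z"
      by eventually_elim (simp add: zero)
  qed simp
  moreover have "sigma m 1 = 1" for m
    by (simp add: sigma_def)
  \<comment> \<open>The coefficient of q is 3 * 240 + 2 * 504.\<close>
  then have "fps_nth D 1 = 1728"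
    by (simp add: D_def E_fps_defs power3_eq_cube power2_eq_square)
  ultimately show False by simp
qed

text \<open>Since \<open>\<Delta>' = E\<^sub>2 \<Delta>\<close>, the quotient of \<open>\<Delta>\<close> by the exponential of a primitive
  of \<open>E\<^sub>2\<close> is constant on the upper half-plane, so a single zero would force \<open>\<Delta> = 0\<close>.\<close>
lemma Delta_nonzero:
  assumes "Im \<tau> > 0"
  shows "Delta \<tau> \<noteq> 0"
proof
  assume zero: "Delta \<tau> = 0"
  let ?H = "{\<tau>. Im \<tau> > 0}" and ?c = "2 * of_real pi * \<i> :: complex"
  have H: "open ?H" "convex ?H"
    using open_halfspace_Im_gt convex_halfspace_Im_gt by auto
  have "E2 holomorphic_on ?H"
    using ramanujan(1) by (auto simp: has_Dq_def H holomorphic_on_open)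
  then have "(\<lambda>\<tau>. ?c * E2 \<tau>) holomorphic_on ?H"
    by (intro holomorphic_intros)
  from holomorphic_convex_primitive'[OF H(2,1) this] obtain G
    where G: "\<And>x. x \<in> ?H \<Longrightarrow> (G has_field_derivative ?c * E2 x) (at x within ?H)"
    by blast
  have "\<exists>C. \<forall>x\<in>?H. Delta x * exp (- G x) = C"
  proof (rule has_field_derivative_zero_constant[OF H(2)])
    fix x assume x: "x \<in> ?H"
    have "(Delta has_field_derivative ?c * (E2 x * Delta x)) (at x within ?H)"
      using has_Dq_Delta x by (auto simp: has_Dq_def intro: has_field_derivative_at_within)
    then show "((\<lambda>x. Delta x * exp (- G x)) has_field_derivative 0) (at x within ?H)"
      using G[OF x] by (auto intro!: derivative_eq_intros simp: algebra_simps)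
  qed
  then obtain C where C: "\<And>x. Im x > 0 \<Longrightarrow> Delta x * exp (- G x) = C"
    by auto
  with zero assms have "C = 0"
    by (metis mult_zero_left)
  with C have "Delta x = 0" if "Im x > 0" for x
    using that by (metis exp_not_eq_zero mult_eq_0_iff)
  then show False
    using Delta_not_identically_zero by blast
qed

subsection \<open>Quasimodular forms\<close>

lemma finite_weights: "finite {(a, b, d). 2 * a + 4 * b + 6 * d = (w::nat)}"
  by (rule finite_subset[of _ "{..w} \<times> {..w} \<times> {..w}"]) auto

lemma quasimodular_cong:
  assumes "quasimodular w f" "\<And>\<tau>. Im \<tau> > 0 \<Longrightarrow> f \<tau> = g \<tau>"
  shows "quasimodular w g"
  using assms unfolding quasimodular_def by auto

lemma quasimodular_monomial:
  assumes "w = 2 * a + 4 * b + 6 * d"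
  shows "quasimodular w (\<lambda>\<tau>. E2 \<tau> ^ a * E4 \<tau> ^ b * E6 \<tau> ^ d)"
proof -
  let ?c = "\<lambda>a' b' d'. if (a', b', d') = (a, b, d) then 1 else 0 :: complex"
  have "(\<Sum>(a', b', d')\<in>{(a, b, d). 2 * a + 4 * b + 6 * d = w}.
      ?c a' b' d' * E2 \<tau> ^ a' * E4 \<tau> ^ b' * E6 \<tau> ^ d')
    = (\<Sum>p\<in>{(a, b, d). 2 * a + 4 * b + 6 * d = w}.
      if p = (a, b, d) then E2 \<tau> ^ a * E4 \<tau> ^ b * E6 \<tau> ^ d else 0)" for \<tau>
    by (intro sum.cong) (auto split: if_splits)
  also have "\<dots> \<tau> = E2 \<tau> ^ a * E4 \<tau> ^ b * E6 \<tau> ^ d" for \<tau>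
    using assms by (subst sum.delta[OF finite_weights]) auto
  finally show ?thesis
    unfolding quasimodular_def by (intro exI[of _ ?c]) auto
qed

lemma quasimodular_add:
  assumes "quasimodular w f" "quasimodular w g"
  shows "quasimodular w (\<lambda>\<tau>. f \<tau> + g \<tau>)"
proof -
  from assms obtain c d where
    "\<forall>\<tau>. Im \<tau> > 0 \<longrightarrow> f \<tau> = (\<Sum>(i,j,k)\<in>{(a,b,d). 2*a + 4*b + 6*d = w}. c i j k * E2 \<tau> ^ i * E4 \<tau> ^ j * E6 \<tau> ^ k)"
    "\<forall>\<tau>. Im \<tau> > 0 \<longrightarrow> g \<tau> = (\<Sum>(i,j,k)\<in>{(a,b,d). 2*a + 4*b + 6*d = w}. d i j k * E2 \<tau> ^ i * E4 \<tau> ^ j * E6 \<tau> ^ k)"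
    unfolding quasimodular_def by blast
  then show ?thesis
    unfolding quasimodular_def
    by (intro exI[of _ "\<lambda>i j k. c i j k + d i j k"])
       (simp add: case_prod_unfold sum.distrib distrib_right)
qed

lemma quasimodular_cmult:
  assumes "quasimodular w f"
  shows "quasimodular w (\<lambda>\<tau>. r * f \<tau>)"
proof -
  from assms obtain c where
    "\<forall>\<tau>. Im \<tau> > 0 \<longrightarrow> f \<tau> = (\<Sum>(i,j,k)\<in>{(a,b,d). 2*a + 4*b + 6*d = w}. c i j k * E2 \<tau> ^ i * E4 \<tau> ^ j * E6 \<tau> ^ k)"
    unfolding quasimodular_def by blast
  then show ?thesis
    unfolding quasimodular_def
    by (intro exI[of _ "\<lambda>i j k. r * c i j k"])
       (simp add: case_prod_unfold sum_distrib_left mult.assoc)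
qed

lemma quasimodular_diff:
  assumes "quasimodular w f" "quasimodular w g"
  shows "quasimodular w (\<lambda>\<tau>. f \<tau> - g \<tau>)"
  using quasimodular_add[OF assms(1) quasimodular_cmult[OF assms(2), of "-1"]] by simp

lemma quasimodular_sum:
  assumes "finite A" "\<And>i. i \<in> A \<Longrightarrow> quasimodular w (f i)"
  shows "quasimodular w (\<lambda>\<tau>. \<Sum>i\<in>A. f i \<tau>)"
  using assms
proof (induction A rule: finite_induct)
  case empty
  have "quasimodular w (\<lambda>\<tau>. 0)"
    unfolding quasimodular_def by (intro exI[of _ "\<lambda>_ _ _. 0"]) simp
  then show ?case by simp
qed (auto intro: quasimodular_add)

text \<open>The product is expanded over pairs of exponent triples; closure under sums then replaces
  collecting equal monomials.\<close>

lemma quasimodular_mult: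
  assumes "quasimodular v f" "quasimodular w g"
  shows "quasimodular (v + w) (\<lambda>\<tau>. f \<tau> * g \<tau>)"
proof -
  let ?S = "\<lambda>w. {(a,b,d). 2*a + 4*b + 6*d = (w::nat)}"
  from assms obtain c d where c:
    "\<forall>\<tau>. Im \<tau> > 0 \<longrightarrow> f \<tau> = (\<Sum>(i,j,k)\<in>?S v. c i j k * E2 \<tau> ^ i * E4 \<tau> ^ j * E6 \<tau> ^ k)"
    "\<forall>\<tau>. Im \<tau> > 0 \<longrightarrow> g \<tau> = (\<Sum>(i,j,k)\<in>?S w. d i j k * E2 \<tau> ^ i * E4 \<tau> ^ j * E6 \<tau> ^ k)"
    unfolding quasimodular_def by blast
  have "quasimodular (v + w) (\<lambda>\<tau>. \<Sum>((i,j,k),(i',j',k'))\<in>?S v \<times> ?S w.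
      c i j k * d i' j' k' * (E2 \<tau> ^ (i + i') * E4 \<tau> ^ (j + j') * E6 \<tau> ^ (k + k')))"
    unfolding case_prod_unfold
    by (intro quasimodular_sum quasimodular_cmult quasimodular_monomial)
       (auto simp: finite_weights[unfolded case_prod_unfold])
  then show ?thesis
    by (rule quasimodular_cong)
       (simp add: c sum_product sum.cartesian_product case_prod_unfold power_add mult_ac)
qed

lemma quasimodular_E: "quasimodular 2 E2" "quasimodular 4 E4" "quasimodular 6 E6"
  using quasimodular_monomial[of 2 1 0 0] quasimodular_monomial[of 4 0 1 0]
    quasimodular_monomial[of 6 0 0 1] by simp_all

lemma quasimodular_Delta: "quasimodular 12 Delta"
proof -
  have "quasimodular 12 (\<lambda>\<tau>. 1 / 1728 * (E4 \<tau> ^ 3 - E6 \<tau> ^ 2))"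
    using quasimodular_monomial[of 12 0 3 0] quasimodular_monomial[of 12 0 0 2]
    by (intro quasimodular_cmult quasimodular_diff) simp_all
  then show ?thesis by (simp add: Delta_def[abs_def])
qed

subsection \<open>The differential equation of Kaneko and Koike\<close>

text \<open>A version of \<open>Fn\<close> free of square roots and quotients. The constant 720 is 3
  * 240, from E4'/240 with E4' = (E2 E4 - E6)/3.\<close>

fun kk_form :: "nat \<Rightarrow> complex \<Rightarrow> complex" where
  "kk_form 0 \<tau> = (E2 \<tau> * E4 \<tau> - E6 \<tau>) / 720"
| "kk_form (Suc 0) \<tau> = E6 \<tau> * kk_form 0 \<tau> - Delta \<tau>"
| "kk_form (Suc (Suc n)) \<tau> = E6 \<tau> * kk_form (Suc n) \<tau> + lam (Suc n) * (Delta \<tau> * kk_form n \<tau>)"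

text \<open>With E6 = s x and s^2 = Delta, multiplying the recursion for P by s^(n+2), and that for
  Q by s^(n+3), turns x into E6 and attaches Delta to \<open>lam\<close>.\<close>

lemma Fn_eq_kk_form:
  assumes "Im \<tau> > 0"
  shows "Fn n \<tau> = kk_form n \<tau>"
proof -
  define s where "s = csqrt (Delta \<tau>)"
  have s: "s \<noteq> 0" "s ^ 2 = Delta \<tau>"
    using Delta_nonzero[OF assms] by (simp_all add: s_def)
  define x where "x = E6 \<tau> / s"
  have x: "E6 \<tau> = s * x"
    using s by (simp add: x_def)
  have "s ^ n * poly (Pp n) x * ((E2 \<tau> * E4 \<tau> - E6 \<tau>) / 720) - s ^ (n + 1) * poly (Qp n) x
      = kk_form n \<tau>"
  proof (induction n rule: Pp.induct)
    case (3 n)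
    show ?case
      unfolding kk_form.simps 3[symmetric] s(2)[symmetric] x Pp.simps Qp.simps
      by (simp add: algebra_simps power2_eq_square)
  qed (simp_all flip: s(2) add: x power2_eq_square)
  moreover have "Dq E4 \<tau> / 240 = (E2 \<tau> * E4 \<tau> - E6 \<tau>) / 720"
    by (simp add: Dq_eq[OF ramanujan(2) assms])
  ultimately show ?thesis
    unfolding Fn_def Let_def s_def[symmetric] x_def[symmetric] times_divide_eq_right[symmetric]
    by (simp only:)
qed

lemma quasimodular_kk_form: "quasimodular (6 * n + 6) (kk_form n)"
proof (induction n rule: less_induct)
  case (less n)
  have mult: "quasimodular u (\<lambda>\<tau>. f \<tau> * g \<tau>)"
    if "quasimodular v f" "quasimodular w g" "u = v + w" for u v w f g
    using quasimodular_mult that by simp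
  have 0: "quasimodular 6 (kk_form 0)"
  proof -
    have "quasimodular 6 (\<lambda>\<tau>. 1 / 720 * (E2 \<tau> * E4 \<tau> - E6 \<tau>))"
      by (intro quasimodular_cmult quasimodular_diff mult[OF quasimodular_E(1,2)] quasimodular_E) simp
    then show ?thesis by (rule quasimodular_cong) simp
  qed
  consider "n = 0" | "n = 1" | m where "n = Suc (Suc m)"
    by (metis One_nat_def old.nat.exhaust)
  then show ?case
  proof cases
    case 1
    then show ?thesis using 0 by (simp del: kk_form.simps)
  next
    case 2
    have "quasimodular 12 (\<lambda>\<tau>. E6 \<tau> * kk_form 0 \<tau> - Delta \<tau>)"
      by (intro quasimodular_diff mult[OF quasimodular_E(3) 0] quasimodular_Delta) simp
    then have "quasimodular 12 (kk_form n)"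
      by (rule quasimodular_cong) (simp add: 2)
    then show ?thesis by (simp add: 2 del: kk_form.simps)
  next
    case 3
    have prev: "quasimodular (6 * m + 6) (kk_form m)" "quasimodular (6 * m + 12) (kk_form (Suc m))"
      using less[of m] less[of "Suc m"] 3 by (simp_all add: algebra_simps)
    have "quasimodular (6 * n + 6)
       (\<lambda>\<tau>. E6 \<tau> * kk_form (Suc m) \<tau> + lam (Suc m) * (Delta \<tau> * kk_form m \<tau>))"
      by (intro quasimodular_add quasimodular_cmult mult[OF quasimodular_E(3) prev(2)]
            mult[OF quasimodular_Delta prev(1)]) (simp_all add: 3)
    then show ?thesis
      by (rule quasimodular_cong) (simp add: 3)
  qed
qed

text \<open>Here \<open>h\<close> is the Serre derivative of \<open>f = kk_form n\<close> in weight \<open>K = 6n + 5\<close>, and the second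
  conjunct is the differential equation of the theorem rewritten in terms of it. The last conjunct
  expresses the next form through the present one; it makes the induction close up, since with it
  the three-term recursion for the next form is a polynomial identity.\<close>
lemma kk_form_system:
  fixes n :: nat
  defines "N \<equiv> of_nat n :: complex"
  defines "K \<equiv> 6 * N + 5"
  shows "\<exists>h. has_Dq (kk_form n) (\<lambda>\<tau>. h \<tau> + K / 12 * (E2 \<tau> * kk_form n \<tau>))
    \<and> has_Dq h (\<lambda>\<tau>. K * (K + 2) / 144 * (E4 \<tau> * kk_form n \<tau>) + (K + 2) / 12 * (E2 \<tau> * h \<tau>))
    \<and> (\<forall>\<tau>. Im \<tau> > 0 \<longrightarrow>
          (N + 1) * kk_form (Suc n) \<tau> = (K + 2) / 12 * (E6 \<tau> * kk_form n \<tau>) - E4 \<tau> * h \<tau>)"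
  unfolding N_def K_def
proof (induction n)
  case 0
  note E2' = ramanujan(1) and E4' = ramanujan(2) and E6' = ramanujan(3)
  have f: "has_Dq (\<lambda>\<tau>. 1 / 720 * (E2 \<tau> * E4 \<tau> - E6 \<tau>))
      (\<lambda>\<tau>. 1 / 720 * ((E2 \<tau> ^ 2 - E4 \<tau>) / 12 * E4 \<tau> + E2 \<tau> * ((E2 \<tau> * E4 \<tau> - E6 \<tau>) / 3)
         - (E2 \<tau> * E6 \<tau> - E4 \<tau> ^ 2) / 2))"
    by (rule has_Dq_cmult has_Dq_diff has_Dq_mult E2' E4' E6')+
  \<comment> \<open>The witness is f' - 5/12 E2 f for \<open>f = kk_form 0\<close>, simplified by
    Ramanujan's formulas.\<close>
  have h: "has_Dq (\<lambda>\<tau>. 1 / 1728 * (E4 \<tau> * E4 \<tau> - E2 \<tau> * E6 \<tau>))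
      (\<lambda>\<tau>. 1 / 1728 * ((E2 \<tau> * E4 \<tau> - E6 \<tau>) / 3 * E4 \<tau> + E4 \<tau> * ((E2 \<tau> * E4 \<tau> - E6 \<tau>) / 3)
         - ((E2 \<tau> ^ 2 - E4 \<tau>) / 12 * E6 \<tau> + E2 \<tau> * ((E2 \<tau> * E6 \<tau> - E4 \<tau> ^ 2) / 2))))"
    by (rule has_Dq_cmult has_Dq_diff has_Dq_mult E2' E4' E6')+
  show ?case
  proof (intro exI conjI allI impI)
    show "has_Dq (kk_form 0) (\<lambda>\<tau>. 1 / 1728 * (E4 \<tau> * E4 \<tau> - E2 \<tau> * E6 \<tau>)
        + (6 * of_nat 0 + 5) / 12 * (E2 \<tau> * kk_form 0 \<tau>))"
      by (rule has_Dq_cong[OF f]) (simp_all add: field_simps power2_eq_square)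
    show "has_Dq (\<lambda>\<tau>. 1 / 1728 * (E4 \<tau> * E4 \<tau> - E2 \<tau> * E6 \<tau>))
      (\<lambda>\<tau>. (6 * of_nat 0 + 5) * (6 * of_nat 0 + 5 + 2) / 144 * (E4 \<tau> * kk_form 0 \<tau>)
        + (6 * of_nat 0 + 5 + 2) / 12 * (E2 \<tau> * (1 / 1728 * (E4 \<tau> * E4 \<tau> - E2 \<tau> * E6 \<tau>))))"
      by (rule has_Dq_cong[OF h]) (simp_all add: field_simps power2_eq_square)
    show "(of_nat 0 + 1) * kk_form (Suc 0) \<tau> = (6 * of_nat 0 + 5 + 2) / 12 * (E6 \<tau> * kk_form 0 \<tau>)
        - E4 \<tau> * (1 / 1728 * (E4 \<tau> * E4 \<tau> - E2 \<tau> * E6 \<tau>))" for \<tau>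
      by (simp add: Delta_def field_simps power2_eq_square power3_eq_cube)
  qed
next
  case (Suc n)
  define N where "N = (of_nat n :: complex)"
  define K where "K = 6 * N + 5"
  define f where "f = kk_form n"
  define f1 where "f1 = kk_form (Suc n)"
  obtain h where f': "has_Dq f (\<lambda>\<tau>. h \<tau> + K / 12 * (E2 \<tau> * f \<tau>))"
    and h': "has_Dq h (\<lambda>\<tau>. K * (K + 2) / 144 * (E4 \<tau> * f \<tau>) + (K + 2) / 12 * (E2 \<tau> * h \<tau>))"
    and step: "\<And>\<tau>. Im \<tau> > 0 \<Longrightarrow>
          (N + 1) * f1 \<tau> = (K + 2) / 12 * (E6 \<tau> * f \<tau>) - E4 \<tau> * h \<tau>"
    using Suc unfolding N_def K_def f_def f1_def by blast
  have N: "N + 1 \<noteq> 0" "N + 2 \<noteq> 0"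
    unfolding N_def by (metis of_nat_Suc of_nat_eq_0_iff nat.distinct(1) add.commute)
      (metis of_nat_add of_nat_numeral of_nat_eq_0_iff add_eq_0_iff_both_eq_0 zero_neq_numeral)
  define c where "c = 1 / (N + 1)"
  have c: "c * (N + 1) = 1" using N by (simp add: c_def)
  have f1: "f1 \<tau> = c * ((K + 2) / 12 * (E6 \<tau> * f \<tau>) - E4 \<tau> * h \<tau>)" if "Im \<tau> > 0" for \<tau>
    by (metis c mult.assoc mult_1 step[OF that])
  \<comment> \<open>The Serre derivative of \<open>f1\<close> in weight K + 6: those of E4 and E6
    are -E6/3 and -E4^2/2, and that of \<open>h\<close> in weight K + 2 is K (K + 2)/144 E4
    f.\<close>
  define h1 where "h1 \<tau> = c * ((K + 6) / 12 * (E6 \<tau> * h \<tau>)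
      - (K + 6) * (K + 2) / 144 * ((E4 \<tau> * E4 \<tau>) * f \<tau>))" for \<tau>
  note E4' = ramanujan(2) and E6' = ramanujan(3)
  have f1': "has_Dq f1 (\<lambda>\<tau>. h1 \<tau> + (K + 6) / 12 * (E2 \<tau> * f1 \<tau>))"
    by (rule has_Dq_cong[OF has_Dq_cmult[where c = c, OF has_Dq_diff[OF
            has_Dq_cmult[where c = "(K + 2) / 12", OF has_Dq_mult[OF E6' f']] has_Dq_mult[OF E4' h']]]])
       (simp_all add: f1 h1_def field_simps power2_eq_square)
  have h1': "has_Dq h1 (\<lambda>\<tau>. (K + 6) * (K + 8) / 144 * (E4 \<tau> * f1 \<tau>) + (K + 8) / 12 * (E2 \<tau> * h1 \<tau>))"
    by (rule has_Dq_cong[OF has_Dq_cmult[where c = c, OF has_Dq_diff[OF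
            has_Dq_cmult[where c = "(K + 6) / 12", OF has_Dq_mult[OF E6' h']]
            has_Dq_cmult[where c = "(K + 6) * (K + 2) / 144", OF has_Dq_mult[OF has_Dq_mult[OF E4' E4'] f']]]]])
       (simp_all add: f1 h1_def field_simps power2_eq_square)
  \<comment> \<open>For m = n + 1 the factors 6m + 1 and 6m + 5 are K + 2 and K + 6.\<close>
  have lam: "(N + 2) * lam (Suc n) = 12 * c * ((K + 2) * (K + 6))"
  proof -
    have "lam (Suc n) = 12 * ((K + 2) * (K + 6)) / ((N + 1) * (N + 2))"
      unfolding lam_def K_def N_def by (intro arg_cong2[where f = "(/)"]) (simp_all add: algebra_simps)
    then show ?thesis using N by (simp add: c_def)
  qed
  have f2: "(N + 2) * kk_form (Suc (Suc n)) \<tau> = (K + 8) / 12 * (E6 \<tau> * f1 \<tau>) - E4 \<tau> * h1 \<tau>"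
    if \<tau>: "Im \<tau> > 0" for \<tau>
  proof -
    have "(N + 2) * kk_form (Suc (Suc n)) \<tau>
      = (N + 2) * (E6 \<tau> * f1 \<tau>) + ((N + 2) * lam (Suc n)) * (Delta \<tau> * f \<tau>)"
      by (simp add: f_def f1_def algebra_simps)
    also have "\<dots> = (N + 2) * (E6 \<tau> * f1 \<tau>) + 12 * c * ((K + 2) * (K + 6)) * (Delta \<tau> * f \<tau>)"
      unfolding lam ..
    \<comment> \<open>As (K + 8)/12 - (N + 2) = -(K + 6)/12, the terms E4 E6 h cancel and E4^3 -
      E6^2 = 1728 Delta remains.\<close>
    also have "\<dots> = (K + 8) / 12 * (E6 \<tau> * f1 \<tau>) - E4 \<tau> * h1 \<tau>"
      unfolding f1[OF \<tau>] h1_def K_def Delta_def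
      by (simp add: field_simps power2_eq_square power3_eq_cube)
    finally show ?thesis .
  qed
  have eqs: "6 * of_nat (Suc n) + 5 = K + 6" "of_nat (Suc n) + 1 = N + 2" "K + 6 + 2 = K + 8"
    by (simp_all add: K_def N_def)
  show ?case
    unfolding eqs using f1' h1' f2 unfolding f1_def by blast
qed

theorem theorem2:
  fixes n k :: nat
  assumes "k = 6*n + 5"
  shows "quasimodular (k+1) (Fn n)
    \<and> (\<forall>\<tau>. Im \<tau> > 0 \<longrightarrow>
          Dq (Dq (Fn n)) \<tau> - of_nat (k+1) / 6 * E2 \<tau> * Dq (Fn n) \<tau>
          + of_nat (k*(k+1)) / 12 * Dq E2 \<tau> * Fn n \<tau> = 0)"
proof (intro conjI allI impI)
  have "k + 1 = 6 * n + 6" using assms by simp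
  then show "quasimodular (k + 1) (Fn n)"
    using quasimodular_cong[OF quasimodular_kk_form, of n "Fn n"] by (simp only: Fn_eq_kk_form)
next
  fix \<tau> :: complex
  assume \<tau>: "Im \<tau> > 0"
  define K where "K = (of_nat k :: complex)"
  have K: "6 * of_nat n + 5 = K"
    using assms by (simp add: K_def)
  define f where "f = Fn n"
  obtain h where "has_Dq (kk_form n) (\<lambda>\<tau>. h \<tau> + K / 12 * (E2 \<tau> * kk_form n \<tau>))"
    and h': "has_Dq h (\<lambda>\<tau>. K * (K + 2) / 144 * (E4 \<tau> * kk_form n \<tau>) + (K + 2) / 12 * (E2 \<tau> * h \<tau>))"
    using kk_form_system[of n] unfolding K by blast
  then have f': "has_Dq f (\<lambda>\<tau>. h \<tau> + K / 12 * (E2 \<tau> * f \<tau>))"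
    unfolding f_def by (elim has_Dq_cong) (simp_all add: Fn_eq_kk_form)
  \<comment> \<open>Eliminating \<open>h\<close> from this leaves a multiple of (E2^2 - E4) f, which
    is 12 E2' f; together with K/12 E2' f it gives -K (K + 1)/12 E2' f.\<close>
  note f'' = has_Dq_add[OF h' has_Dq_cmult[where c = "K / 12", OF has_Dq_mult[OF ramanujan(1) f']]]
  have "kk_form n \<tau> = f \<tau>"
    using Fn_eq_kk_form[OF \<tau>] by (simp add: f_def)
  then show "Dq (Dq (Fn n)) \<tau> - of_nat (k+1) / 6 * E2 \<tau> * Dq (Fn n) \<tau>
          + of_nat (k*(k+1)) / 12 * Dq E2 \<tau> * Fn n \<tau> = 0"
    unfolding f_def[symmetric] Dq_Dq_eq[OF f' f'' \<tau>] Dq_eq[OF f' \<tau>] Dq_eq[OF ramanujan(1) \<tau>]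
      of_nat_mult of_nat_add of_nat_1 K_def[symmetric]
    by (simp add: field_simps power2_eq_square)
qed

end
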